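(* Let $\mathcal{X}$ be an infinite-dimensional real Banach space and let $\mathcal{A}\subset\mathcal{B}(\mathcal{X})$ be an $L$-algebra of complex type. Then there is a closed partial complex structure $S$ on $\mathcal{X}$ such that $\mathcal{A}\subset\mathcal{A}_S$, where $\mathcal{A}_S=\{T\in\mathcal{B}(\mathcal{X}): TS\subset ST\}$.
   Context: $\mathcal{B}(\mathcal{X})$ is the algebra of all bounded linear operators on $\mathcal{X}$. A partial complex structure on $\mathcal{X}$ is a linear operator $S$ defined on a dense linear subspace $\mathcal{D}(S)\subset\mathcal{X}$, taking values in $\mathcal{X}$, such that $S^{-1}=-S$ (so $S\mathcal{D}(S)=\mathcal{D}(S)$ and $S^2x=-x$ for $x\in\mathcal{D}(S)$); it is closed if it is a closed operator. $TS\subset ST$ means that for all $x\in\mathcal{D}(S)$ one has $Tx\in\mathcal{D}(S)$ and $TSx=STx$. A subalgebra of $\mathcal{B}(\mathcal{X})$ (not assumed unital or closed) is transitive if it has no non-trivial closed invariant subspaces. An $L$-algebra is a transitive subalgebra of $\mathcal{B}(\mathcal{X})$ containing a non-zero finite rank operator. For an $L$-algebra $\mathcal{A}$, $\mathcal{A}^F$ is the set of all finite rank operators in $\mathcal{A}$, $\mathcal{X}^F=\mathrm{lin}\{Tx: T\in\mathcal{A}^F, x\in\mathcal{X}\}$, and $\mathbb{D}$ is the algebra of all linear operators $\mathcal{X}^F\to\mathcal{X}^F$ (not assumed bounded) commuting with the restrictions to $\mathcal{X}^F$ of all operators in $\mathcal{A}^F$; $\mathbb{D}$ is always isomorphic to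 $\mathbb{R}$, $\mathbb{C}$ or the quaternions $\mathbb{H}$, and $\mathcal{A}$ is said to be of real, complex or quaternion type, respectively. *)

theory Defs
  imports "HOL-Analysis.Analysis"
begin

definition finite_dim :: "'a::real_vector set \<Rightarrow> bool" where
  "finite_dim V \<longleftrightarrow> (\<exists>B. finite B \<and> V \<subseteq> span B)"

definition linear_within :: "'a::real_vector set \<Rightarrow> ('a \<Rightarrow> 'b::real_vector) \<Rightarrow> bool" where
  "linear_within V f \<longleftrightarrow> subspace V \<and>
     (\<forall>x\<in>V. \<forall>y\<in>V. f (x + y) = f x + f y) \<and>
     (\<forall>c. \<forall>x\<in>V. f (c *\<^sub>R x) = c *\<^sub>R f x)"


subsection \<open>Partial complex structures\<close>

text \<open>
  A partially defined operator is given by its domain \<open>D\<close> together with a total function \<open>S\<close>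
  whose values outside \<open>D\<close> are irrelevant.  In the identity of partial operators
  \<open>S\<^sup>-\<^sup>1 = - S\<close> the left side has domain \<open>S ` D\<close> and the right side has domain \<open>D\<close>.
\<close>

definition partial_complex_structure :: "'a::real_normed_vector set \<Rightarrow> ('a \<Rightarrow> 'a) \<Rightarrow> bool" where
  "partial_complex_structure D S \<longleftrightarrow>
     closure D = UNIV \<and> linear_within D S \<and>
     inj_on S D \<and> S ` D = D \<and> (\<forall>x\<in>D. inv_into D S x = - S x)"

definition closed_operator :: "'a::real_normed_vector set \<Rightarrow> ('a \<Rightarrow> 'b::real_normed_vector) \<Rightarrow> bool" where
  "closed_operator D S \<longleftrightarrow> closed ((\<lambda>x. (x, S x)) ` D)"

definition commuting_bounded_ops ::
    "'a::real_normed_vector set \<Rightarrow> ('a \<Rightarrow> 'a) \<Rightarrow> ('a \<Rightarrow>\<^sub>L 'a) set" where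
  "commuting_bounded_ops D S =
     {T. \<forall>x\<in>D. blinfun_apply T x \<in> D \<and> blinfun_apply T (S x) = S (blinfun_apply T x)}"


subsection \<open>\<open>L\<close>-algebras\<close>

definition operator_subalgebra :: "('a::real_normed_vector \<Rightarrow>\<^sub>L 'a) set \<Rightarrow> bool" where
  "operator_subalgebra A \<longleftrightarrow> subspace A \<and> (\<forall>T\<in>A. \<forall>U\<in>A. T o\<^sub>L U \<in> A)"

definition transitive_ops :: "('a::real_normed_vector \<Rightarrow>\<^sub>L 'a) set \<Rightarrow> bool" where
  "transitive_ops A \<longleftrightarrow>
     (\<forall>M. subspace M \<and> closed M \<and> (\<forall>T\<in>A. blinfun_apply T ` M \<subseteq> M) \<longrightarrow> M = {0} \<or> M = UNIV)"

definition finite_rank :: "('a::real_normed_vector \<Rightarrow>\<^sub>L 'b::real_normed_vector) \<Rightarrow> bool" where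
  "finite_rank T \<longleftrightarrow> finite_dim (range (blinfun_apply T))"

definition finite_rank_part :: "('a::real_normed_vector \<Rightarrow>\<^sub>L 'a) set \<Rightarrow> ('a \<Rightarrow>\<^sub>L 'a) set" where
  "finite_rank_part A = {T \<in> A. finite_rank T}"

definition L_algebra :: "('a::real_normed_vector \<Rightarrow>\<^sub>L 'a) set \<Rightarrow> bool" where
  "L_algebra A \<longleftrightarrow>
     operator_subalgebra A \<and> transitive_ops A \<and> (\<exists>T\<in>A. T \<noteq> 0 \<and> finite_rank T)"

definition finite_rank_space :: "('a::real_normed_vector \<Rightarrow>\<^sub>L 'a) set \<Rightarrow> 'a set" where
  "finite_rank_space A = span {blinfun_apply T x | T x. T \<in> finite_rank_part A}"

text \<open>
  Operators on \<open>finite_rank_space A\<close> are represented by functions that are \<open>undefined\<close> outside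
  this subspace, so that each operator is represented by exactly one function.
\<close>

definition division_commutant :: "('a::real_normed_vector \<Rightarrow>\<^sub>L 'a) set \<Rightarrow> ('a \<Rightarrow> 'a) set" where
  "division_commutant A =
     {R \<in> finite_rank_space A \<rightarrow>\<^sub>E finite_rank_space A.
        linear_within (finite_rank_space A) R \<and>
        (\<forall>T\<in>finite_rank_part A. \<forall>x\<in>finite_rank_space A.
           R (blinfun_apply T x) = blinfun_apply T (R x))}"

definition operator_algebra_iso ::
    "'a::real_vector set \<Rightarrow> ('a \<Rightarrow> 'a) set \<Rightarrow> ('k::real_algebra_1 \<Rightarrow> 'a \<Rightarrow> 'a) \<Rightarrow> bool" where
  "operator_algebra_iso V D \<phi> \<longleftrightarrow>
     bij_betw \<phi> UNIV D \<and>
     \<phi> 1 = (\<lambda>x\<in>V. x) \<and>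
     (\<forall>a b. \<phi> (a + b) = (\<lambda>x\<in>V. \<phi> a x + \<phi> b x)) \<and>
     (\<forall>r a. \<phi> (r *\<^sub>R a) = (\<lambda>x\<in>V. r *\<^sub>R \<phi> a x)) \<and>
     (\<forall>a b. \<phi> (a * b) = compose V (\<phi> a) (\<phi> b))"

definition complex_type :: "('a::real_normed_vector \<Rightarrow>\<^sub>L 'a) set \<Rightarrow> bool" where
  "complex_type A \<longleftrightarrow>
     (\<exists>\<phi> :: complex \<Rightarrow> 'a \<Rightarrow> 'a.
        operator_algebra_iso (finite_rank_space A) (division_commutant A) \<phi>)"

end

theory Submission
  imports Defs
begin

text \<open>
  Let \<open>J\<close> be the operator on the finite rank space \<open>V\<close> of \<open>A\<close> that corresponds to the imaginary
  unit.  It is a complex structure on \<open>V\<close>, possibly unbounded, and the wanted \<open>S\<close> is a closed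
  extension of it.  Instead of the closure of \<open>J\<close>, the proof uses the largest extension that the
  commutation relations permit: \<open>S x = y\<close> means that \<open>U y = J (U x)\<close> for all finite rank \<open>U \<in> A\<close>.
  This condition makes sense for all \<open>x\<close> and \<open>y\<close>, because every such \<open>U\<close> maps the whole space
  into \<open>V\<close>, and each required property of \<open>S\<close> can be read off from it.

  \<^item> The relation is closed: \<open>J \<circ> U\<close> factors through the finite-dimensional range of \<open>U\<close>, on which
    the linear map \<open>J\<close> is automatically bounded (\<open>bounded_linear_compose_finite_rank\<close>).
  \<^item> It is single-valued: the finite rank operators of \<open>A\<close> have no common kernel vector except \<open>0\<close>,
    since their joint kernel is a closed invariant subspace (\<open>L_algebra_joint_kernel\<close>).
  \<^item> Its domain is dense: it contains \<open>V\<close>, whose closure is a closed invariant subspace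
    (\<open>L_algebra_finite_rank_space_dense\<close>).
  \<^item> It is stable under \<open>(x, y) \<mapsto> (y, - x)\<close>, because \<open>J\<^sup>2 = - 1\<close>; for a single-valued relation
    this says \<open>S\<^sup>-\<^sup>1 = - S\<close> (\<open>partial_complex_structure_of_graph\<close>).
  \<^item> It is invariant under every \<open>T \<in> A\<close>: with \<open>U\<close> also \<open>U \<circ> T\<close> is a finite rank operator in \<open>A\<close>,
    so \<open>U (T y) = J (U (T x))\<close>.
\<close>


section \<open>Linear maps with finite-dimensional domain or range\<close>

text \<open>
  The distance \<open>d\<close> of \<open>b\<close> from \<open>span B\<close> is positive, and by homogeneity it controls the
  coefficient of \<open>b\<close>.  So the coefficients of a convergent sequence in \<open>span (insert b B)\<close> form a
  Cauchy sequence, and the limit decomposes in the same way.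
\<close>

lemma closed_span_insert:
  fixes b :: "'a::real_normed_vector"
  assumes B: "closed (span B)" and b: "b \<notin> span B"
  obtains d where "d > 0" "\<And>c w. w \<in> span B \<Longrightarrow> d * \<bar>c\<bar> \<le> norm (c *\<^sub>R b + w)"
    and "closed (span (insert b B))"
proof -
  have ne: "span B \<noteq> {}" using span_zero by blast
  define d where "d = infdist b (span B)"
  have d: "d > 0"
    unfolding d_def using infdist_pos_not_in_closed[OF B ne b] .
  have bound: "d * \<bar>c\<bar> \<le> norm (c *\<^sub>R b + w)" if w: "w \<in> span B" for c w
  proof (cases "c = 0")
    case False
    have "d \<le> dist b ((- inverse c) *\<^sub>R w)"
      unfolding d_def by (intro infdist_le span_scale w)
    also have "\<dots> = norm (inverse c *\<^sub>R (c *\<^sub>R b + w))"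
      using False by (simp add: dist_norm algebra_simps)
    also have "\<dots> = norm (c *\<^sub>R b + w) / \<bar>c\<bar>"
      by (simp add: divide_inverse mult.commute)
    finally show ?thesis
      using False by (simp add: field_simps)
  qed simp
  have "closed (span (insert b B))"
    unfolding closed_sequential_limits
  proof (intro allI impI, elim conjE)
    fix y l
    assume "\<forall>n. y n \<in> span (insert b B)" and lim: "y \<longlonglongrightarrow> l"
    then have "\<forall>n. \<exists>c. y n - c *\<^sub>R b \<in> span B"
      by (auto simp: span_insert)
    then obtain c where c: "\<And>n. y n - c n *\<^sub>R b \<in> span B"
      by metis
    have diff: "d * dist (c m) (c n) \<le> dist (y m) (y n)" for m n
      using bound[OF span_diff[OF c[of m] c[of n]], of "c m - c n"]
      by (simp add: dist_norm algebra_simps)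
    have "Cauchy c"
    proof (rule metric_CauchyI)
      fix e :: real assume "e > 0"
      then obtain M where M: "\<And>m n. m \<ge> M \<Longrightarrow> n \<ge> M \<Longrightarrow> dist (y m) (y n) < d * e"
        using metric_CauchyD[OF LIMSEQ_imp_Cauchy[OF lim], of "d * e"] d by auto
      have "dist (c m) (c n) < e" if "m \<ge> M" "n \<ge> M" for m n
        using le_less_trans[OF diff[of m n] M[OF that]] d by simp
      then show "\<exists>M. \<forall>m\<ge>M. \<forall>n\<ge>M. dist (c m) (c n) < e" by blast
    qed
    then obtain k where k: "c \<longlonglongrightarrow> k"
      using Cauchy_convergent convergentD by blast
    have "(\<lambda>n. y n - c n *\<^sub>R b) \<longlonglongrightarrow> l - k *\<^sub>R b"
      by (intro tendsto_intros lim k)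
    then have "l - k *\<^sub>R b \<in> span B"
      by (rule closed_sequentially[OF B c])
    then show "l \<in> span (insert b B)"
      by (auto simp: span_insert)
  qed
  with d bound that show ?thesis by blast
qed

lemma closed_span_finite:
  fixes B :: "'a::real_normed_vector set"
  assumes "finite B"
  shows "closed (span B)"
  using assms
proof (induction B)
  case (insert b B)
  show ?case
  proof (cases "b \<in> span B")
    case True
    then show ?thesis using insert.IH by (simp add: span_redundant)
  next
    case False
    from closed_span_insert[OF insert.IH this] show ?thesis by metis
  qed
qed simp

text \<open>
  Induction over \<open>B\<close>: in \<open>x = c b + w\<close> with \<open>w \<in> span B\<close>, the coefficient \<open>c\<close> and hence also
  \<open>w = x - c b\<close> are bounded by a multiple of the norm of \<open>x\<close>.
\<close>
lemma linear_within_span_bounded: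
  fixes B :: "'a::real_normed_vector set" and f :: "'a \<Rightarrow> 'b::real_normed_vector"
  assumes "finite B" and "linear_within (span B) f"
  shows "\<exists>K\<ge>0. \<forall>x\<in>span B. norm (f x) \<le> K * norm x"
  using assms
proof (induction B)
  case empty
  then have "f 0 = 0"
    unfolding linear_within_def by (metis scaleR_zero_left span_zero)
  then show ?case by (auto intro: exI[of _ 0])
next
  case (insert b B)
  note f = insert.prems
  show ?case
  proof (cases "b \<in> span B")
    case True
    then show ?thesis using insert by (simp add: span_redundant)
  next
    case False
    from closed_span_insert[OF closed_span_finite[OF insert.hyps(1)] this]
    obtain d where d: "d > 0"
      and bound: "\<And>c w. w \<in> span B \<Longrightarrow> d * \<bar>c\<bar> \<le> norm (c *\<^sub>R b + w)"
      by metis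
    have sub: "span B \<subseteq> span (insert b B)"
      by (intro span_mono) auto
    have b: "b \<in> span (insert b B)"
      by (simp add: span_base)
    have "linear_within (span B) f"
      using f sub unfolding linear_within_def by (auto simp: subset_iff)
    then obtain K where K: "K \<ge> 0" "\<And>w. w \<in> span B \<Longrightarrow> norm (f w) \<le> K * norm w"
      using insert.IH by blast
    define L where "L = norm (f b) / d + K * (1 + norm b / d)"
    have "norm (f x) \<le> L * norm x" if x: "x \<in> span (insert b B)" for x
    proof -
      obtain c where c: "x - c *\<^sub>R b \<in> span B"
        using x by (auto simp: span_insert)
      define w where "w = x - c *\<^sub>R b"
      have w: "w \<in> span B" and xw: "x = c *\<^sub>R b + w"
        using c by (simp_all add: w_def)
      have cx: "\<bar>c\<bar> \<le> norm x / d"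
        using bound[OF w, of c] d by (simp add: xw field_simps)
      have "norm w \<le> norm x + \<bar>c\<bar> * norm b"
        unfolding w_def using norm_triangle_ineq4[of x "c *\<^sub>R b"] by simp
      also have "\<dots> \<le> norm x + norm x / d * norm b"
        using cx by (intro add_left_mono mult_right_mono) auto
      finally have wx: "norm w \<le> norm x + norm x / d * norm b" .
      have "f x = c *\<^sub>R f b + f w"
        using f b w sub unfolding linear_within_def xw
        by (metis subsetD span_scale)
      then have "norm (f x) \<le> \<bar>c\<bar> * norm (f b) + norm (f w)"
        by (metis norm_scaleR norm_triangle_ineq)
      also have "\<dots> \<le> norm x / d * norm (f b) + K * (norm x + norm x / d * norm b)"
        using cx order_trans[OF K(2)[OF w] mult_left_mono[OF wx K(1)]]
        by (intro add_mono mult_right_mono) auto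
      also have "\<dots> = L * norm x"
        by (simp add: L_def field_simps)
      finally show ?thesis .
    qed
    moreover have "L \<ge> 0" using K(1) d by (simp add: L_def)
    ultimately show ?thesis by blast
  qed
qed

text \<open>
  On the finite-dimensional range of \<open>U\<close> the map \<open>f\<close> is bounded, even if it is unbounded on \<open>V\<close>.
\<close>
lemma bounded_linear_compose_finite_rank:
  fixes U :: "'a::real_normed_vector \<Rightarrow>\<^sub>L 'b::real_normed_vector" and f :: "'b \<Rightarrow> 'c::real_normed_vector"
  assumes U: "finite_rank U" and f: "linear_within V f" and V: "range (blinfun_apply U) \<subseteq> V"
  shows "bounded_linear (\<lambda>x. f (U x))"
proof -
  have sub: "subspace (range (blinfun_apply U))"
    by (simp add: blinfun.bounded_linear_right bounded_linear.linear linear_subspace_image)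
  obtain B where B: "finite B" "range (blinfun_apply U) \<subseteq> span B"
    using U unfolding finite_rank_def finite_dim_def by blast
  obtain C where C: "C \<subseteq> range (blinfun_apply U)" "independent C"
      "range (blinfun_apply U) \<subseteq> span C"
    using maximal_independent_subset by blast
  have "finite C"
    using independent_span_bound[OF B(1) C(2)] C(1) B(2) by blast
  moreover have C_span: "span C = range (blinfun_apply U)"
    using C sub by (simp add: span_minimal subset_antisym)
  moreover have "linear_within (range (blinfun_apply U)) f"
    using f V sub unfolding linear_within_def by (auto simp: subset_iff)
  ultimately obtain K where K: "K \<ge> 0" "\<And>x. norm (f (U x)) \<le> K * norm (U x)"
    using linear_within_span_bounded[of C f] by auto
  show ?thesis
  proof (rule bounded_linear_intro)
    show "f (U (x + y)) = f (U x) + f (U y)" for x y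
      using f V unfolding linear_within_def by (simp add: blinfun.add_right image_subset_iff)
    show "f (U (r *\<^sub>R x)) = r *\<^sub>R f (U x)" for r x
      using f V unfolding linear_within_def by (simp add: blinfun.scaleR_right image_subset_iff)
    show "norm (f (U x)) \<le> norm x * (K * norm U)" for x
      using order_trans[OF K(2) mult_left_mono[OF norm_blinfun[of U x] K(1)]]
      by (simp add: mult_ac)
  qed
qed


section \<open>Partial complex structures from their graphs\<close>

text \<open>
  If \<open>S\<close> is the operator with graph \<open>G\<close>, then \<open>rot\<close> says that \<open>S\<close> maps its domain into itself and
  that \<open>S (S x) = - x\<close>.
\<close>
lemma partial_complex_structure_of_graph:
  fixes G :: "('a::real_normed_vector \<times> 'a) set"
  assumes G: "subspace G"
    and fn: "\<And>y. (0, y) \<in> G \<Longrightarrow> y = 0"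
    and rot: "\<And>x y. (x, y) \<in> G \<Longrightarrow> (y, - x) \<in> G"
    and dense: "closure (fst ` G) = UNIV"
  obtains D S where "partial_complex_structure D S" "(\<lambda>x. (x, S x)) ` D = G"
proof -
  define D where "D = fst ` G"
  define S where "S x = (THE y. (x, y) \<in> G)" for x
  have uniq: "y = z" if "(x, y) \<in> G" "(x, z) \<in> G" for x y z
    using fn[of "y - z"] subspace_diff[OF G that] by simp
  have S_eq: "S x = y" if "(x, y) \<in> G" for x y
    unfolding S_def using that uniq by blast
  have S_in: "(x, S x) \<in> G" if "x \<in> D" for x
    using that S_eq unfolding D_def by force
  have D_in: "x \<in> D" if "(x, y) \<in> G" for x y
    using that unfolding D_def by force
  have S_D: "S x \<in> D" and SS: "S (S x) = - x" if "x \<in> D" for x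
    using rot[OF S_in[OF that]] D_in S_eq by auto
  have "subspace D"
    unfolding D_def by (intro linear_subspace_image G) (simp add: linear_fst)
  moreover have "S (x + y) = S x + S y" if "x \<in> D" "y \<in> D" for x y
    using subspace_add[OF G S_in[OF that(1)] S_in[OF that(2)]] S_eq by simp
  moreover have S_scale: "S (c *\<^sub>R x) = c *\<^sub>R S x" if "x \<in> D" for c x
    using subspace_scale[OF G S_in[OF that], of c] S_eq by simp
  ultimately have lin: "linear_within D S"
    unfolding linear_within_def by blast
  have neg: "- S x \<in> D" "S (- S x) = x" if "x \<in> D" for x
    using S_D[OF that] SS[OF that] S_scale[OF S_D[OF that], of "-1"]
      subspace_neg[OF \<open>subspace D\<close>] by auto
  have inj: "inj_on S D"
    by (rule inj_onI) (metis SS neg_equal_iff_equal)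
  have "S ` D = D"
    using S_D neg by (force simp: image_iff)
  moreover have "inv_into D S x = - S x" if "x \<in> D" for x
    using inv_into_f_eq[OF inj neg[OF that]] .
  ultimately have "partial_complex_structure D S"
    unfolding partial_complex_structure_def using lin inj dense by (simp add: D_def)
  moreover have "(\<lambda>x. (x, S x)) ` D = G"
    using S_in S_eq D_in by (auto simp: image_iff)
  ultimately show ?thesis by (rule that)
qed


section \<open>Finite rank operators in an \<open>L\<close>-algebra\<close>

lemma finite_rank_compose:
  fixes T :: "'b::real_normed_vector \<Rightarrow>\<^sub>L 'c::real_normed_vector"
    and U :: "'a::real_normed_vector \<Rightarrow>\<^sub>L 'b"
  shows "finite_rank T \<Longrightarrow> finite_rank (T o\<^sub>L U)"
    and "finite_rank U \<Longrightarrow> finite_rank (T o\<^sub>L U)"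
proof -
  show "finite_rank (T o\<^sub>L U)" if T: "finite_rank T"
  proof -
    obtain B where "finite B" "range (blinfun_apply T) \<subseteq> span B"
      using T unfolding finite_rank_def finite_dim_def by blast
    moreover have "range (blinfun_apply (T o\<^sub>L U)) \<subseteq> range (blinfun_apply T)" by auto
    ultimately show ?thesis unfolding finite_rank_def finite_dim_def by blast
  qed
  show "finite_rank (T o\<^sub>L U)" if U: "finite_rank U"
  proof -
    obtain B where B: "finite B" "range (blinfun_apply U) \<subseteq> span B"
      using U unfolding finite_rank_def finite_dim_def by blast
    have "blinfun_apply T ` span B = span (blinfun_apply T ` B)"
      by (simp add: blinfun.bounded_linear_right bounded_linear.linear linear_span_image)
    then have "range (blinfun_apply (T o\<^sub>L U)) \<subseteq> span (blinfun_apply T ` B)"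
      using B(2) by auto
    with B(1) show ?thesis unfolding finite_rank_def finite_dim_def by blast
  qed
qed

lemma L_algebra_finite_rank_part_ideal:
  assumes "L_algebra A" and "T \<in> A" and "U \<in> finite_rank_part A"
  shows "U o\<^sub>L T \<in> finite_rank_part A" and "T o\<^sub>L U \<in> finite_rank_part A"
  using assms finite_rank_compose
  unfolding finite_rank_part_def L_algebra_def operator_subalgebra_def by blast+

lemma subspace_closure:
  fixes V :: "'a::real_normed_vector set"
  assumes V: "subspace V"
  shows "subspace (closure V)"
  unfolding subspace_def
proof (intro conjI ballI allI)
  show "0 \<in> closure V"
    using closure_subset subspace_0[OF V] by blast
next
  fix x y assume "x \<in> closure V" "y \<in> closure V"
  then obtain f g where "\<forall>n. f n \<in> V" "f \<longlonglongrightarrow> x" "\<forall>n. g n \<in> V" "g \<longlonglongrightarrow> y"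
    unfolding closure_sequential by blast
  then show "x + y \<in> closure V"
    unfolding closure_sequential
    by (intro exI[of _ "\<lambda>n. f n + g n"]) (auto intro: tendsto_add subspace_add[OF V])
next
  fix c x assume "x \<in> closure V"
  then obtain f where "\<forall>n. f n \<in> V" "f \<longlonglongrightarrow> x"
    unfolding closure_sequential by blast
  then show "c *\<^sub>R x \<in> closure V"
    unfolding closure_sequential
    by (intro exI[of _ "\<lambda>n. c *\<^sub>R f n"]) (auto intro: tendsto_scaleR subspace_scale[OF V])
qed

text \<open>
  The joint kernel of the finite rank operators in \<open>A\<close> is closed, and it is invariant under \<open>A\<close>
  because these operators form a right ideal.  It is not the whole space, as one of them is
  non-zero, so transitivity leaves only \<open>{0}\<close>.
\<close>
lemma L_algebra_joint_kernel:
  assumes A: "L_algebra A" and x: "\<And>U. U \<in> finite_rank_part A \<Longrightarrow> blinfun_apply U x = 0"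
  shows "x = 0"
proof -
  define N where "N = (\<Inter>U\<in>finite_rank_part A. {x. blinfun_apply U x = 0})"
  have "subspace N"
    unfolding N_def subspace_def by (auto simp: blinfun.add_right blinfun.scaleR_right)
  moreover have "closed N"
    unfolding N_def by (intro closed_INT ballI closed_Collect_eq continuous_intros)
  moreover have "blinfun_apply T ` N \<subseteq> N" if T: "T \<in> A" for T
    using L_algebra_finite_rank_part_ideal(1)[OF A T] unfolding N_def by fastforce
  ultimately have "N = {0} \<or> N = UNIV"
    using A unfolding L_algebra_def transitive_ops_def by blast
  moreover obtain U where "U \<in> finite_rank_part A" "U \<noteq> 0"
    using A unfolding L_algebra_def finite_rank_part_def by blast
  then have "N \<noteq> UNIV"
    unfolding N_def by (metis (mono_tags) INT_D UNIV_I blinfun_eqI mem_Collect_eq zero_blinfun.rep_eq)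
  ultimately show ?thesis
    using x unfolding N_def by blast
qed

text \<open>
  The finite rank operators in \<open>A\<close> form a left ideal, so \<open>A\<close> leaves the span of their ranges
  invariant, and by continuity also its closure, which is not \<open>{0}\<close> since one of these operators is non-zero.
\<close>
lemma L_algebra_finite_rank_space_dense:
  assumes A: "L_algebra A"
  shows "closure (finite_rank_space A) = UNIV"
proof -
  let ?V = "finite_rank_space A"
  have V: "subspace ?V"
    unfolding finite_rank_space_def by simp
  have "blinfun_apply T ` closure ?V \<subseteq> closure ?V" if T: "T \<in> A" for T
  proof -
    note L_algebra_finite_rank_part_ideal(2)[OF A T]
    then have *: "blinfun_apply T ` {blinfun_apply U x | U x. U \<in> finite_rank_part A}
        \<subseteq> {blinfun_apply U x | U x. U \<in> finite_rank_part A}"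
      by (auto, metis blinfun_apply_blinfun_compose)
    have "blinfun_apply T ` ?V \<subseteq> ?V"
      using span_mono[OF *] unfolding finite_rank_space_def
      by (simp add: blinfun.bounded_linear_right bounded_linear.linear linear_span_image)
    then show ?thesis
      by (intro image_closure_subset closed_closure subset_trans[OF _ closure_subset])
        (intro continuous_intros)
  qed
  moreover obtain U x where "U \<in> finite_rank_part A" "blinfun_apply U x \<noteq> 0"
    using A unfolding L_algebra_def finite_rank_part_def
    by (metis (mono_tags, lifting) blinfun_eqI mem_Collect_eq zero_blinfun.rep_eq)
  then have "blinfun_apply U x \<in> ?V"
    unfolding finite_rank_space_def by (intro span_base) blast
  then have "closure ?V \<noteq> {0}"
    using closure_subset \<open>blinfun_apply U x \<noteq> 0\<close> by blast
  moreover have "subspace (closure ?V)"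
    using V by (rule subspace_closure)
  ultimately show ?thesis
    using A closed_closure[of ?V] unfolding L_algebra_def transitive_ops_def by metis
qed


section \<open>The closed partial complex structure\<close>

lemma complex_type_obtains_imaginary_unit:
  assumes "complex_type A"
  obtains J where "J \<in> division_commutant A"
    and "\<And>x. x \<in> finite_rank_space A \<Longrightarrow> J (J x) = - x"
proof -
  let ?V = "finite_rank_space A"
  obtain \<phi> :: "complex \<Rightarrow> 'a \<Rightarrow> 'a"
    where iso: "operator_algebra_iso ?V (division_commutant A) \<phi>"
    using assms unfolding complex_type_def by blast
  have "\<phi> \<i> \<in> division_commutant A"
    using iso unfolding operator_algebra_iso_def bij_betw_def by blast
  moreover have "\<phi> \<i> (\<phi> \<i> x) = - x" if x: "x \<in> ?V" for x
  proof -
    have "\<phi> \<i> (\<phi> \<i> x) = compose ?V (\<phi> \<i>) (\<phi> \<i>) x"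
      using x by (simp add: compose_def)
    also have "\<dots> = \<phi> (\<i> * \<i>) x"
      using iso unfolding operator_algebra_iso_def by metis
    also have "\<i> * \<i> = (-1) *\<^sub>R (1 :: complex)"
      by simp
    also have "\<phi> ((-1) *\<^sub>R 1) = (\<lambda>x\<in>?V. (-1) *\<^sub>R (\<lambda>x\<in>?V. x) x)"
      using iso unfolding operator_algebra_iso_def by metis
    finally show ?thesis using x by simp
  qed
  ultimately show ?thesis by (rule that)
qed

theorem theorem3p4:
  fixes A :: "('a::banach \<Rightarrow>\<^sub>L 'a) set"
  assumes "\<not> finite_dim (UNIV :: 'a set)"
    and "L_algebra A"
    and "complex_type A"
  shows "\<exists>D S. partial_complex_structure D S \<and> closed_operator D S \<and>
           A \<subseteq> commuting_bounded_ops D S"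
proof -
  let ?V = "finite_rank_space A" and ?F = "finite_rank_part A"
  obtain J where J: "J \<in> division_commutant A" and JJ: "\<And>x. x \<in> ?V \<Longrightarrow> J (J x) = - x"
    using complex_type_obtains_imaginary_unit[OF assms(3)] by blast
  have lin: "linear_within ?V J"
    and comm: "\<And>U x. U \<in> ?F \<Longrightarrow> x \<in> ?V \<Longrightarrow> J (blinfun_apply U x) = blinfun_apply U (J x)"
    using J unfolding division_commutant_def by auto
  have F_V: "blinfun_apply U x \<in> ?V" if "U \<in> ?F" for U x
    using that unfolding finite_rank_space_def by (blast intro: span_base)
  have JU: "bounded_linear (\<lambda>x. J (blinfun_apply U x))" if "U \<in> ?F" for U
    using that F_V[OF that]
    by (intro bounded_linear_compose_finite_rank[OF _ lin]) (auto simp: finite_rank_part_def)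
  \<comment> \<open>The graph of the largest extension of \<open>J\<close> compatible with the finite rank operators of \<open>A\<close>.\<close>
  define G where "G = (\<Inter>U\<in>?F. {(x, y). blinfun_apply U y = J (blinfun_apply U x)})"
  have G_iff: "(x, y) \<in> G \<longleftrightarrow> (\<forall>U\<in>?F. blinfun_apply U y = J (blinfun_apply U x))" for x y
    unfolding G_def by auto
  have J_add: "J (blinfun_apply U (x + y)) = J (blinfun_apply U x) + J (blinfun_apply U y)"
    and J_scale: "J (blinfun_apply U (c *\<^sub>R x)) = c *\<^sub>R J (blinfun_apply U x)"
    and J_zero: "J (blinfun_apply U 0) = 0" if "U \<in> ?F" for U x y c
    using linear_simps[OF JU[OF that]] by blast+
  have "closed {(x, y). blinfun_apply U y = J (blinfun_apply U x)}" if "U \<in> ?F" for U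
  proof -
    have "continuous_on UNIV (\<lambda>p :: 'a \<times> 'a. J (blinfun_apply U (fst p)))"
      by (rule bounded_linear.continuous_on[OF JU[OF that]]) (intro continuous_intros)
    moreover have "continuous_on UNIV (\<lambda>p :: 'a \<times> 'a. blinfun_apply U (snd p))"
      by (intro continuous_intros)
    ultimately show ?thesis
      unfolding case_prod_beta by (intro closed_Collect_eq)
  qed
  then have closed: "closed G"
    unfolding G_def by blast
  have "subspace G"
  proof (rule subspaceI)
    show "0 \<in> G"
      by (simp add: zero_prod_def G_iff J_zero del: blinfun.zero_right) simp
    show "p + q \<in> G" if "p \<in> G" "q \<in> G" for p q
      using that by (cases p; cases q) (simp add: G_iff J_add, simp add: blinfun.add_right)
    show "c *\<^sub>R p \<in> G" if "p \<in> G" for c p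
      using that by (cases p) (simp add: G_iff J_scale, simp add: blinfun.scaleR_right)
  qed
  moreover have "y = 0" if y: "(0, y) \<in> G" for y
  proof (rule L_algebra_joint_kernel[OF assms(2)])
    show "blinfun_apply U y = 0" if "U \<in> ?F" for U
      using y J_zero[OF that] that unfolding G_iff by simp
  qed
  moreover have "(y, - x) \<in> G" if "(x, y) \<in> G" for x y
    using that by (simp add: G_iff blinfun.minus_right JJ F_V)
  moreover have "?V \<subseteq> fst ` G"
  proof
    fix x assume "x \<in> ?V"
    then have "(x, J x) \<in> G" by (simp add: G_iff comm)
    then show "x \<in> fst ` G" by force
  qed
  from closure_mono[OF this] have "closure (fst ` G) = UNIV"
    unfolding L_algebra_finite_rank_space_dense[OF assms(2)] by blast
  ultimately obtain D S where S: "partial_complex_structure D S"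
    and graph: "(\<lambda>x. (x, S x)) ` D = G"
    by (rule partial_complex_structure_of_graph)
  have "closed_operator D S"
    unfolding closed_operator_def graph by (rule closed)
  moreover have "T \<in> commuting_bounded_ops D S" if T: "T \<in> A" for T
  proof -
    note L_algebra_finite_rank_part_ideal(1)[OF assms(2) T]
    then have "(blinfun_apply T x, blinfun_apply T y) \<in> G" if "(x, y) \<in> G" for x y
      using that unfolding G_iff by (metis blinfun_apply_blinfun_compose)
    then have "(blinfun_apply T x, blinfun_apply T (S x)) \<in> (\<lambda>x. (x, S x)) ` D" if "x \<in> D" for x
      using that graph by blast
    then show ?thesis
      unfolding commuting_bounded_ops_def by auto
  qed
  ultimately show ?thesis using S by blast
qed

end
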